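(* Let $\gamma : I\to\mathbb{R}^3$ be a smooth curve on an open interval $I$ parametrized by arc length $s$, with nowhere vanishing curvature and unit tangent $T$. Let $c$ be a real constant with $c-s>0$ for all $s\in I$, and let $\widetilde\gamma=\gamma+(c-s)T$ be the involute of $\gamma$, with arc-length parameter $s^*$, Frenet frame $\{\widetilde T,\widetilde N,\widetilde B\}$, curvature $\widetilde\kappa>0$, torsion $\widetilde\tau$, and $\widetilde f=\widetilde\tau/\widetilde\kappa$. Let $\widetilde\gamma_t=\widetilde T$ be the tangent indicatrix of $\widetilde\gamma$, with arc-length parameter $s_t^*$ (oriented so that $ds_t^*/ds^*>0$). Then $$\frac{ds^*}{ds_t^*}=\frac{1}{\widetilde\kappa},$$ the Frenet frame of $\widetilde\gamma_t$ is $$\widetilde T_t=\widetilde N,\qquad \widetilde N_t=\frac{-\widetilde T+\widetilde f\,\widetilde B}{\sqrt{1+\widetilde f^2}},\qquad \widetilde B_t=\frac{\widetilde f\,\widetilde T+\widetilde B}{\sqrt{1+\widetilde f^2}},$$ and it satisfies $$\frac{d\widetilde T_t}{ds_t^*}=\widetilde\kappa_t\widetilde N_t,\qquad \frac{d\widetilde N_t}{ds_t^*}=-\widetilde\kappa_t\widetilde T_t+\widetilde\tau_t\widetilde B_t,\qquad \frac{d\widetilde B_t}{ds_t^*}=-\widetilde\tau_t\widetilde N_t,$$ where the curvature and torsion of $\widetilde\gamma_t$ are $$\widetilde\kappa_t=\sqrt{1+\widetilde f^2},\qquad \widetilde\tau_t=\frac{\widetilde f'}{\widetilde\kappa\,(1+\widetilde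 f^2)}.$$ Moreover, the geodesic curvature $\widetilde\Gamma_t$ of the principal image of the principal normal indicatrix of $\widetilde\gamma_t$ is $$\widetilde\Gamma_t=\frac{\left\{(1+\widetilde f^2)(\widetilde f''\widetilde\kappa-\widetilde f'\widetilde\kappa')-3\widetilde\kappa\widetilde f(\widetilde f')^2\right\}(1+\widetilde f^2)^{3/2}}{\left(\widetilde\kappa^2(1+\widetilde f^2)^3+(\widetilde f')^2\right)^{3/2}}.$$ Here primes on $\widetilde f$ and $\widetilde\kappa$ denote derivatives with respect to $s^*$.
   Context: Frenet formulas with respect to arc length: $T'=\kappa N$, $N'=-\kappa T+\tau B$, $B'=-\tau N$, with $B=T\times N$. The tangent indicatrix of $\widetilde\gamma$ is the curve traced on the unit sphere by its unit tangent vector $\widetilde T$. For a curve with arc-length parameter $u$, curvature $k>0$, torsion $t$ and $g=t/k$, the "geodesic curvature of the principal image of the principal normal indicatrix" is the function $\frac{dg/du}{k(1+g^2)^{3/2}}$. Thus $\widetilde\Gamma_t=\frac{d(\widetilde\tau_t/\widetilde\kappa_t)/ds_t^*}{\widetilde\kappa_t(1+(\widetilde\tau_t/\widetilde\kappa_t)^2)^{3/2}}$. *)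

theory Defs
  imports "HOL-Analysis.Analysis"
begin

unbundle cross3_syntax

definition smooth_curve_on :: "real set \<Rightarrow> (real \<Rightarrow> real^3) \<Rightarrow> bool" where
  "smooth_curve_on I \<alpha> \<longleftrightarrow>
     (\<forall>n. \<forall>s\<in>I. ((\<lambda>g x. vector_derivative g (at x)) ^^ n) \<alpha> differentiable (at s))"

(* The Frenet apparatus below is that of a curve parametrized by arc length;
   the definitions are meant to be applied to such curves only. *)

definition unit_tangent :: "(real \<Rightarrow> real^3) \<Rightarrow> real \<Rightarrow> real^3" where
  "unit_tangent \<alpha> s = vector_derivative \<alpha> (at s)"

definition curvature :: "(real \<Rightarrow> real^3) \<Rightarrow> real \<Rightarrow> real" where
  "curvature \<alpha> s = norm (vector_derivative (unit_tangent \<alpha>) (at s))"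

definition principal_normal :: "(real \<Rightarrow> real^3) \<Rightarrow> real \<Rightarrow> real^3" where
  "principal_normal \<alpha> s = (1 / curvature \<alpha> s) *\<^sub>R vector_derivative (unit_tangent \<alpha>) (at s)"

definition binormal :: "(real \<Rightarrow> real^3) \<Rightarrow> real \<Rightarrow> real^3" where
  "binormal \<alpha> s = unit_tangent \<alpha> s \<times> principal_normal \<alpha> s"

(* sign convention: B' = - \<tau> N *)
definition torsion :: "(real \<Rightarrow> real^3) \<Rightarrow> real \<Rightarrow> real" where
  "torsion \<alpha> s = - (vector_derivative (binormal \<alpha>) (at s) \<bullet> principal_normal \<alpha> s)"

(* Geodesic curvature of the principal image of the principal normal indicatrix
   of a curve parametrized by arc length. *)
definition normal_indicatrix_geodesic_curvature :: "(real \<Rightarrow> real^3) \<Rightarrow> real \<Rightarrow> real" where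
  "normal_indicatrix_geodesic_curvature \<alpha> s =
     deriv (\<lambda>x. torsion \<alpha> x / curvature \<alpha> x) s /
     (curvature \<alpha> s * (1 + (torsion \<alpha> s / curvature \<alpha> s)\<^sup>2) powr (3/2))"

definition involute :: "(real \<Rightarrow> real^3) \<Rightarrow> real \<Rightarrow> real \<Rightarrow> real^3" where
  "involute \<alpha> c s = \<alpha> s + (c - s) *\<^sub>R unit_tangent \<alpha> s"

definition tangent_indicatrix :: "(real \<Rightarrow> real^3) \<Rightarrow> real \<Rightarrow> real^3" where
  "tangent_indicatrix \<alpha> = unit_tangent \<alpha>"

(* \<sigma> is an arc-length parameter, increasing in the given parameter and unique up to an
   additive constant, of the differentiable curve \<alpha> on the open interval I. *)
definition arc_length_parameter :: "(real \<Rightarrow> real^3) \<Rightarrow> real set \<Rightarrow> (real \<Rightarrow> real) \<Rightarrow> bool" where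
  "arc_length_parameter \<alpha> I \<sigma> \<longleftrightarrow>
     (\<forall>s\<in>I. (\<sigma> has_real_derivative norm (vector_derivative \<alpha> (at s))) (at s))"

(* The curve \<alpha> on I, expressed as a function of its arc-length parameter \<sigma>. The values
   are meaningful on the image of I under \<sigma>; for a regular curve \<sigma> is injective on I. *)
definition reparametrize :: "(real \<Rightarrow> real^3) \<Rightarrow> real set \<Rightarrow> (real \<Rightarrow> real) \<Rightarrow> real \<Rightarrow> real^3" where
  "reparametrize \<alpha> I \<sigma> = \<alpha> \<circ> inv_into I \<sigma>"

end

theory Submission
  imports Defs
begin

text \<open>
  Both halves of the theorem are instances of one step: replace the parameter of a curve by arc
  length and read off the Frenet apparatus by the chain rule.

  The first step concerns the involute. Its velocity is
  \<open>(\<gamma> + (c - s) T)' = (c - s) \<kappa> N\<close>, so on \<open>I\<close> it is regular, and in its own arc length its unit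
  tangent at the point over \<open>s\<close> is \<open>N(s)\<close>. By the Frenet equations of \<open>\<gamma>\<close> the derivative of that
  tangent is a positive multiple of \<open>-\<kappa> T + \<tau> B\<close>, which does not vanish because \<open>\<kappa>\<close> does not. Hence
  the reparametrized involute \<open>\<alpha>\<close> is again a smooth unit-speed curve with positive curvature
  (\<open>involute_unit_speed_reparametrization\<close>).

  The second step concerns the tangent indicatrix of any such \<open>\<alpha>\<close>. The speed of \<open>T\<close> is \<open>\<kappa>\<close>, so
  differentiation in the new arc length is \<open>(1/\<kappa>) d/du\<close>. With \<open>f = \<tau>/\<kappa>\<close> and \<open>w = sqrt (1 + f\<^sup>2)\<close>
  this gives for the indicatrix \<open>\<beta>\<close>: tangent \<open>N\<close>; derivative of the tangent
  \<open>(1/\<kappa>) (-\<kappa> T + \<tau> B) = -T + f B\<close>, of length \<open>w\<close>; binormal \<open>(f T + B)/w\<close>. The numerator of the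
  binormal has derivative \<open>f' T\<close>, since \<open>f \<kappa> N - \<tau> N = 0\<close>, and pairing the derivative of the
  quotient with the normal yields the torsion \<open>f'/(\<kappa> w\<^sup>2)\<close> (\<open>indicatrix_torsion\<close>). Since \<open>\<beta>\<close> is itself a smooth
  unit-speed curve with nonvanishing curvature, its three Frenet equations are those of a general
  curve (\<open>indicatrix_frenet_curve\<close>). Finally, \<open>\<Gamma>\<close> comes from differentiating \<open>f'/(\<kappa> w\<^sup>3)\<close>, the ratio of torsion to curvature
  of \<open>\<beta>\<close>.

  Two things need care. The formula for \<open>\<Gamma>\<close> contains second derivatives of curvature and torsion, so
  smoothness must be carried through products, roots, quotients and inverse functions; this is
  done by counting derivatives. And the Frenet quantities of a reparametrized curve are derivatives
  of functions that are known only on the image of the parameter interval; that this image is open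
  makes the derivatives at its points independent of the values elsewhere.
\<close>

section \<open>Smooth functions of a real variable\<close>

text \<open>
  The derivative is quantified existentially rather than taken as \<open>vector_derivative f\<close>, so that a
  closure property only has to exhibit some derivative formula; the induction hypothesis then
  applies to that formula.
\<close>

primrec times_differentiable_on :: "nat \<Rightarrow> real set \<Rightarrow> (real \<Rightarrow> 'a::real_normed_vector) \<Rightarrow> bool" where
  "times_differentiable_on 0 S f \<longleftrightarrow> True"
| "times_differentiable_on (Suc n) S f \<longleftrightarrow>
     (\<exists>f'. (\<forall>x\<in>S. (f has_vector_derivative f' x) (at x)) \<and> times_differentiable_on n S f')"

definition smooth_on :: "real set \<Rightarrow> (real \<Rightarrow> 'a::real_normed_vector) \<Rightarrow> bool" where
  "smooth_on S f \<longleftrightarrow> (\<forall>n. times_differentiable_on n S f)"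

lemma times_differentiable_on_SucD:
  "times_differentiable_on (Suc n) S f \<Longrightarrow> times_differentiable_on n S f"
  by (induction n arbitrary: f) auto

text \<open>
  On an open set a derivative at a point depends only on the values in the set.
\<close>

lemma times_differentiable_on_cong:
  assumes "open S" "\<And>x. x \<in> S \<Longrightarrow> f x = g x" "times_differentiable_on n S f"
  shows "times_differentiable_on n S g"
proof (cases n)
  case (Suc m)
  then obtain f' where f': "\<forall>x\<in>S. (f has_vector_derivative f' x) (at x)"
    "times_differentiable_on m S f'"
    using assms(3) by auto
  have "(g has_vector_derivative f' x) (at x)" if "x \<in> S" for x
    using f'(1) that assms(1,2) has_vector_derivative_transform_within_open by blast
  then show ?thesis using f'(2) Suc by auto
qed auto

lemma smooth_on_cong:
  assumes "smooth_on S f" "open S" "\<And>x. x \<in> S \<Longrightarrow> f x = g x"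
  shows "smooth_on S g"
  using assms times_differentiable_on_cong unfolding smooth_on_def by blast

lemma smooth_on_has_vector_derivative:
  assumes "smooth_on S f" "x \<in> S"
  shows "(f has_vector_derivative vector_derivative f (at x)) (at x)"
proof -
  have "times_differentiable_on (Suc 0) S f" using assms(1) smooth_on_def by blast
  then show ?thesis using assms(2) vector_derivative_at by fastforce
qed

lemma smooth_on_vector_derivative:
  assumes "smooth_on S f" "open S"
  shows "smooth_on S (\<lambda>x. vector_derivative f (at x))"
  unfolding smooth_on_def
proof
  fix n
  have "times_differentiable_on (Suc n) S f" using assms(1) smooth_on_def by blast
  then obtain f' where f': "\<forall>x\<in>S. (f has_vector_derivative f' x) (at x)"
    "times_differentiable_on n S f'" by auto
  show "times_differentiable_on n S (\<lambda>x. vector_derivative f (at x))"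
    by (rule times_differentiable_on_cong[OF assms(2) _ f'(2)])
       (use f'(1) vector_derivative_at in metis)
qed

lemma smooth_on_const: "smooth_on S (\<lambda>x. c)"
proof -
  have "times_differentiable_on n S (\<lambda>x. c)" for n and c :: 'a
    by (induction n arbitrary: c) (auto intro!: exI[of _ "\<lambda>x. 0"] has_vector_derivative_const)
  then show ?thesis by (simp add: smooth_on_def)
qed

lemma smooth_on_id: "smooth_on S (\<lambda>x. x)"
  unfolding smooth_on_def
proof
  fix n show "times_differentiable_on n S (\<lambda>x::real. x)"
  proof (cases n)
    case (Suc m)
    have "times_differentiable_on m S (\<lambda>x. 1::real)"
      using smooth_on_const smooth_on_def by blast
    then show ?thesis
      using Suc by (auto intro!: exI[of _ "\<lambda>x. 1"])
  qed auto
qed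

lemma times_differentiable_on_add:
  "times_differentiable_on n S f \<Longrightarrow> times_differentiable_on n S g \<Longrightarrow>
   times_differentiable_on n S (\<lambda>x. f x + g x)"
proof (induction n arbitrary: f g)
  case (Suc n)
  then obtain f' g' where fg: "\<forall>x\<in>S. (f has_vector_derivative f' x) (at x)"
    "\<forall>x\<in>S. (g has_vector_derivative g' x) (at x)"
    "times_differentiable_on n S f'" "times_differentiable_on n S g'"
    by auto
  have "\<forall>x\<in>S. ((\<lambda>x. f x + g x) has_vector_derivative f' x + g' x) (at x)"
    using fg(1,2) by (auto intro: has_vector_derivative_add)
  with Suc.IH[OF fg(3,4)] show ?case by auto
qed auto

lemma smooth_on_add:
  "smooth_on S f \<Longrightarrow> smooth_on S g \<Longrightarrow> smooth_on S (\<lambda>x. f x + g x)"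
  using times_differentiable_on_add unfolding smooth_on_def by blast

context bounded_bilinear
begin

lemma times_differentiable_on:
  "times_differentiable_on n S f \<Longrightarrow> times_differentiable_on n S g \<Longrightarrow>
   times_differentiable_on n S (\<lambda>x. prod (f x) (g x))"
proof (induction n arbitrary: f g)
  case (Suc n)
  then obtain f' g' where fg: "\<forall>x\<in>S. (f has_vector_derivative f' x) (at x)"
    "\<forall>x\<in>S. (g has_vector_derivative g' x) (at x)"
    "times_differentiable_on n S f'" "times_differentiable_on n S g'"
    by auto
  have "\<forall>x\<in>S. ((\<lambda>x. prod (f x) (g x)) has_vector_derivative prod (f x) (g' x) + prod (f' x) (g x)) (at x)"
    using fg(1,2) by (auto intro: has_vector_derivative)
  moreover have "times_differentiable_on n S (\<lambda>x. prod (f x) (g' x) + prod (f' x) (g x))"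
    using Suc.IH fg(3,4) Suc.prems
    by (intro times_differentiable_on_add) (auto dest!: times_differentiable_on_SucD simp del: times_differentiable_on.simps)
  ultimately show ?case by auto
qed auto

lemma smooth_on:
  "smooth_on S f \<Longrightarrow> smooth_on S g \<Longrightarrow> smooth_on S (\<lambda>x. prod (f x) (g x))"
  using times_differentiable_on unfolding smooth_on_def by blast

end

lemma bounded_bilinear_cross3: "bounded_bilinear (\<times>)"
  using bilinear_cross bilinear_conv_bounded_bilinear by blast

lemmas smooth_on_scaleR = bounded_bilinear.smooth_on[OF bounded_bilinear_scaleR]
  and smooth_on_mult = bounded_bilinear.smooth_on[OF bounded_bilinear_mult]
  and smooth_on_inner = bounded_bilinear.smooth_on[OF bounded_bilinear_inner]
  and smooth_on_cross3 = bounded_bilinear.smooth_on[OF bounded_bilinear_cross3]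

lemmas has_vector_derivative_inner =
    bounded_bilinear.has_vector_derivative[OF bounded_bilinear_inner]
  and has_vector_derivative_cross3 =
    bounded_bilinear.has_vector_derivative[OF bounded_bilinear_cross3]

lemma smooth_on_minus: "smooth_on S f \<Longrightarrow> smooth_on S (\<lambda>x. - f x)"
  using smooth_on_scaleR[OF smooth_on_const[of S "-1"], of f] by simp

text \<open>
  The derivative of the composite is a product with factor \<open>g' \<circ> p\<close>, which is a composite again with
  one derivative less on each side; hence the induction over all \<open>g\<close>.
\<close>

lemma times_differentiable_on_compose:
  fixes g :: "real \<Rightarrow> 'a::real_normed_vector"
  shows "times_differentiable_on n S p \<Longrightarrow> p ` S \<subseteq> U \<Longrightarrow> times_differentiable_on n U g \<Longrightarrow>
    times_differentiable_on n S (\<lambda>x. g (p x))"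
proof (induction n arbitrary: g)
  case (Suc n)
  then obtain p' g' where pg: "\<forall>x\<in>S. (p has_vector_derivative p' x) (at x)"
    "\<forall>x\<in>U. (g has_vector_derivative g' x) (at x)"
    "times_differentiable_on n S p'" "times_differentiable_on n U g'"
    by auto
  have "\<forall>x\<in>S. ((\<lambda>x. g (p x)) has_vector_derivative p' x *\<^sub>R g' (p x)) (at x)"
    using pg(1,2) Suc.prems(2) by (auto intro!: vector_diff_chain_at[unfolded o_def])
  moreover have "times_differentiable_on n S (\<lambda>x. p' x *\<^sub>R g' (p x))"
    using Suc.IH[OF times_differentiable_on_SucD[OF Suc.prems(1)] Suc.prems(2) pg(4)] pg(3)
    by (intro bounded_bilinear.times_differentiable_on[OF bounded_bilinear_scaleR])
  ultimately show ?case by auto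
qed auto

lemma smooth_on_compose:
  assumes "smooth_on U g" "smooth_on S p" "p ` S \<subseteq> U"
  shows "smooth_on S (\<lambda>x. g (p x))"
  using assms times_differentiable_on_compose unfolding smooth_on_def by blast

text \<open>
  The derivatives of \<open>inverse\<close> and of \<open>sqrt\<close> below are polynomial in \<open>inverse\<close> and \<open>sqrt\<close> themselves,
  so each order of differentiability yields the next.
\<close>

lemma times_differentiable_on_inverse: "times_differentiable_on n (- {0}) (inverse :: real \<Rightarrow> real)"
proof (induction n)
  case (Suc n)
  have "\<forall>x\<in>-{0}. (inverse has_vector_derivative (-1) * (inverse x * inverse x)) (at x)"
    by (auto simp: has_real_derivative_iff_has_vector_derivative[symmetric] power2_eq_square
        intro!: derivative_eq_intros)
  moreover have "times_differentiable_on n (- {0}) (\<lambda>x. (-1) * (inverse x * inverse x) :: real)"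
    using Suc smooth_on_const[of "- {0}" "-1::real"]
    by (intro bounded_bilinear.times_differentiable_on[OF bounded_bilinear_mult])
       (auto simp: smooth_on_def)
  ultimately show ?case by auto
qed auto

lemma times_differentiable_on_sqrt: "times_differentiable_on n {0<..} sqrt"
proof (induction n)
  case (Suc n)
  have "\<forall>x\<in>{0<..}. (sqrt has_vector_derivative (1/2) * (inverse x * sqrt x)) (at x)"
    by (auto simp: has_real_derivative_iff_has_vector_derivative[symmetric]
         field_simps intro!: derivative_eq_intros)
  moreover have "times_differentiable_on n {0<..} (\<lambda>x. (1/2) * (inverse x * sqrt x) :: real)"
    using Suc smooth_on_const[of "{0<..}" "1/2::real"] smooth_on_id[of "{0<..}"]
    by (intro bounded_bilinear.times_differentiable_on[OF bounded_bilinear_mult]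
          times_differentiable_on_compose[OF _ _ times_differentiable_on_inverse])
       (auto simp: smooth_on_def)
  ultimately show ?case by auto
qed auto

lemma smooth_on_inverse:
  fixes f :: "real \<Rightarrow> real"
  assumes "smooth_on S f" "\<And>x. x \<in> S \<Longrightarrow> f x \<noteq> 0"
  shows "smooth_on S (\<lambda>x. inverse (f x))"
  using assms times_differentiable_on_inverse
  by (intro smooth_on_compose[OF _ assms(1)]) (auto simp: smooth_on_def)

lemma smooth_on_divide:
  fixes f g :: "real \<Rightarrow> real"
  assumes "smooth_on S f" "smooth_on S g" "\<And>x. x \<in> S \<Longrightarrow> g x \<noteq> 0"
  shows "smooth_on S (\<lambda>x. f x / g x)"
  using smooth_on_mult[OF assms(1) smooth_on_inverse[OF assms(2,3)]] by (simp add: divide_inverse)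

lemma smooth_on_norm:
  fixes f :: "real \<Rightarrow> 'a::real_inner"
  assumes "smooth_on S f" "\<And>x. x \<in> S \<Longrightarrow> f x \<noteq> 0"
  shows "smooth_on S (\<lambda>x. norm (f x))"
  unfolding norm_eq_sqrt_inner
  using assms(2) times_differentiable_on_sqrt
  by (intro smooth_on_compose[OF _ smooth_on_inner[OF assms(1,1)]]) (auto simp: smooth_on_def)

text \<open>
  A bootstrap for autonomous equations \<open>p' = g(p)\<close>: if \<open>p\<close> has \<open>n\<close> derivatives then so has \<open>g \<circ> p\<close>,
  that is, \<open>p'\<close>. For \<open>g = 1 / \<sigma>'\<close> the solution is the inverse of \<open>\<sigma>\<close>.
\<close>

lemma smooth_on_inverse_function:
  assumes "smooth_on U g"
    and "\<And>y. y \<in> S \<Longrightarrow> (p has_real_derivative g (p y)) (at y)" and "p ` S \<subseteq> U"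
  shows "smooth_on S p"
proof -
  have "times_differentiable_on n S p" for n
  proof (induction n)
    case (Suc n)
    have "times_differentiable_on n S (\<lambda>y. g (p y))"
      using times_differentiable_on_compose[OF Suc assms(3)] assms(1) smooth_on_def by blast
    then show ?case
      using assms(2)
      by (auto simp: has_real_derivative_iff_has_vector_derivative intro!: exI[of _ "\<lambda>y. g (p y)"])
  qed auto
  then show ?thesis by (simp add: smooth_on_def)
qed

lemma smooth_curve_on_imp_smooth_on:
  assumes "smooth_curve_on S \<alpha>"
  shows "smooth_on S \<alpha>"
proof -
  define D where "D = (\<lambda>(g :: real \<Rightarrow> real^3) x. vector_derivative g (at x))"
  have D: "(D ^^ n) \<alpha> differentiable (at s)" if "s \<in> S" for n s
    using assms that by (auto simp: smooth_curve_on_def D_def)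
  have "times_differentiable_on n S ((D ^^ m) \<alpha>)" for n m
  proof (induction n arbitrary: m)
    case (Suc n)
    have "((D ^^ m) \<alpha> has_vector_derivative (D ^^ Suc m) \<alpha> s) (at s)" if "s \<in> S" for s
      using D[OF that, of m] by (simp add: D_def vector_derivative_works)
    then show ?case using Suc.IH[of "Suc m"] by auto
  qed auto
  from this[of _ 0] show ?thesis by (simp add: smooth_on_def)
qed

lemma smooth_on_has_real_derivative:
  "smooth_on S f \<Longrightarrow> x \<in> S \<Longrightarrow> (f has_real_derivative deriv f x) (at x)"
  using smooth_on_has_vector_derivative DERIV_deriv_iff_real_differentiable differentiableI_vector
  by blast

lemma smooth_on_deriv:
  fixes f :: "real \<Rightarrow> real"
  assumes "smooth_on S f" "open S"
  shows "smooth_on S (deriv f)"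
proof (rule smooth_on_cong[OF smooth_on_vector_derivative[OF assms] assms(2)])
  fix x assume "x \<in> S"
  then show "vector_derivative f (at x) = deriv f x"
    using smooth_on_has_real_derivative[OF assms(1)]
    by (simp add: has_real_derivative_iff_has_vector_derivative vector_derivative_at)
qed

section \<open>Passing to an arc-length parameter\<close>

text \<open>
  An interval as domain makes positivity of the derivative force \<open>\<sigma>\<close> to be increasing, hence
  injective; an injective continuous map between open subsets of the line is open, and the
  inverse function theorem applies.
\<close>

lemma arc_length_parameter_inverse:
  fixes \<sigma> g :: "real \<Rightarrow> real"
  assumes "open I" "is_interval I"
    and \<sigma>: "\<forall>s\<in>I. (\<sigma> has_real_derivative g s) (at s)"
    and g: "\<forall>s\<in>I. g s > 0"
  shows "open (\<sigma> ` I)" "is_interval (\<sigma> ` I)"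
    and "\<And>s. s \<in> I \<Longrightarrow> inv_into I \<sigma> (\<sigma> s) = s"
    and "\<And>s. s \<in> I \<Longrightarrow> (inv_into I \<sigma> has_real_derivative 1 / g s) (at (\<sigma> s))"
proof -
  have less: "\<sigma> a < \<sigma> b" if "a \<in> I" "b \<in> I" "a < b" for a b
  proof (rule DERIV_pos_imp_increasing[OF that(3)])
    fix x assume "a \<le> x" "x \<le> b"
    then have "x \<in> I" using assms(2) that by (meson is_interval_1)
    then show "\<exists>y. DERIV \<sigma> x :> y \<and> 0 < y" using \<sigma> g by blast
  qed
  have inj: "inj_on \<sigma> I"
    by (rule linorder_inj_onI) (use less in force)+
  have cont: "continuous_on I \<sigma>"
    using \<sigma> by (meson DERIV_isCont continuous_at_imp_continuous_on)
  show "open (\<sigma> ` I)"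
    by (rule injective_into_1d_imp_open_map_UNIV[OF assms(1) cont inj subset_refl])
  show "is_interval (\<sigma> ` I)"
    using connected_continuous_image[OF cont] assms(2) by (simp add: is_interval_connected_1)
  show inv: "inv_into I \<sigma> (\<sigma> s) = s" if "s \<in> I" for s
    using inj that by simp
  show "(inv_into I \<sigma> has_real_derivative 1 / g s) (at (\<sigma> s))" if "s \<in> I" for s
    unfolding has_field_derivative_def
  proof (rule has_derivative_inverse_strong[OF assms(1) that cont inv])
    show "(\<sigma> has_derivative (*) (g s)) (at s)"
      using \<sigma> that by (simp add: has_field_derivative_def)
    show "(*) (g s) \<circ> (*) (1 / g s) = id"
      using g that by (auto simp: fun_eq_iff)
  qed
qed

text \<open>
  The rule \<open>d/d\<sigma> = (1/g) d/ds\<close> for \<open>d\<sigma>/ds = g\<close>, with \<open>F\<close> constrained on the image of \<open>I\<close> only. In this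
  form it differentiates Frenet vectors of a reparametrized curve, which are known at the points
  \<open>\<sigma> s\<close> and nowhere else.
\<close>

lemma has_vector_derivative_wrt_arc_length:
  fixes \<sigma> g :: "real \<Rightarrow> real"
  assumes I: "open I" "is_interval I"
    "\<forall>s\<in>I. (\<sigma> has_real_derivative g s) (at s)" "\<forall>s\<in>I. g s > 0"
    and s: "s \<in> I" and F: "\<And>x. x \<in> I \<Longrightarrow> F (\<sigma> x) = h x"
    and h': "(h has_vector_derivative h') (at s)"
  shows "(F has_vector_derivative (1 / g s) *\<^sub>R h') (at (\<sigma> s))"
proof -
  note inverse = arc_length_parameter_inverse[OF I]
  have "((h \<circ> inv_into I \<sigma>) has_vector_derivative (1 / g s) *\<^sub>R h') (at (\<sigma> s))"
    using inverse(3,4)[OF s] h'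
    by (intro vector_diff_chain_at) (simp_all add: has_real_derivative_iff_has_vector_derivative)
  then show ?thesis
    by (rule has_vector_derivative_transform_within_open[OF _ inverse(1)])
       (use s F inverse(3) in auto)
qed

section \<open>The Frenet equations\<close>

lemma unit_vector_field_orthogonal_derivative:
  fixes F :: "real \<Rightarrow> 'a::real_inner"
  assumes "open S" "x \<in> S" "\<And>y. y \<in> S \<Longrightarrow> norm (F y) = 1"
    and F': "(F has_vector_derivative F') (at x)"
  shows "F' \<bullet> F x = 0"
proof -
  have "((\<lambda>y. F y \<bullet> F y) has_vector_derivative F x \<bullet> F' + F' \<bullet> F x) (at x)"
    by (rule has_vector_derivative_inner[OF F' F'])
  moreover have "((\<lambda>y. F y \<bullet> F y) has_vector_derivative 0) (at x)"
    by (rule has_vector_derivative_transform_within_open[OF has_vector_derivative_const[of 1] assms(1,2)])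
       (simp add: assms(3) norm_eq_1[symmetric] flip: power2_norm_eq_inner)
  ultimately have "F x \<bullet> F' + F' \<bullet> F x = 0"
    by (rule vector_derivative_unique_at)
  then show ?thesis by (simp add: inner_commute)
qed

locale frenet_curve =
  fixes \<alpha> :: "real \<Rightarrow> real^3" and J :: "real set"
  assumes open_domain: "open J"
    and smooth: "smooth_on J \<alpha>"
    and unit_speed: "u \<in> J \<Longrightarrow> norm (unit_tangent \<alpha> u) = 1"
    and curvature_nonzero: "u \<in> J \<Longrightarrow> curvature \<alpha> u \<noteq> 0"
begin

lemma curvature_pos: "u \<in> J \<Longrightarrow> curvature \<alpha> u > 0"
  using curvature_nonzero[of u] unfolding curvature_def by simp

lemma smooth_unit_tangent: "smooth_on J (unit_tangent \<alpha>)"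
  using smooth_on_vector_derivative[OF smooth open_domain] by (simp add: unit_tangent_def[abs_def])

lemma smooth_tangent_derivative: "smooth_on J (\<lambda>u. vector_derivative (unit_tangent \<alpha>) (at u))"
  by (rule smooth_on_vector_derivative[OF smooth_unit_tangent open_domain])

lemma smooth_curvature: "smooth_on J (curvature \<alpha>)"
  unfolding curvature_def[abs_def]
  by (rule smooth_on_norm[OF smooth_tangent_derivative]) (use curvature_nonzero in \<open>auto simp: curvature_def\<close>)

lemma smooth_principal_normal: "smooth_on J (principal_normal \<alpha>)"
  unfolding principal_normal_def[abs_def]
  by (intro smooth_on_scaleR smooth_on_divide smooth_on_const smooth_curvature
      smooth_tangent_derivative curvature_nonzero)

lemma smooth_binormal: "smooth_on J (binormal \<alpha>)"
  unfolding binormal_def[abs_def]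
  by (intro smooth_on_cross3 smooth_unit_tangent smooth_principal_normal)

lemma smooth_torsion: "smooth_on J (torsion \<alpha>)"
  unfolding torsion_def[abs_def]
  by (intro smooth_on_minus smooth_on_inner smooth_on_vector_derivative smooth_binormal
      smooth_principal_normal open_domain)

lemma tangent_has_derivative:
  assumes "u \<in> J"
  shows "(unit_tangent \<alpha> has_vector_derivative curvature \<alpha> u *\<^sub>R principal_normal \<alpha> u) (at u)"
  using smooth_on_has_vector_derivative[OF smooth_unit_tangent assms] curvature_nonzero[OF assms]
  by (simp add: principal_normal_def)

lemma norm_principal_normal: "u \<in> J \<Longrightarrow> norm (principal_normal \<alpha> u) = 1"
  using curvature_nonzero[of u] by (simp add: principal_normal_def curvature_def)

lemma frame_inner:
  assumes "u \<in> J"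
  shows "unit_tangent \<alpha> u \<bullet> unit_tangent \<alpha> u = 1"
    and "principal_normal \<alpha> u \<bullet> principal_normal \<alpha> u = 1"
    and "binormal \<alpha> u \<bullet> binormal \<alpha> u = 1"
    and "unit_tangent \<alpha> u \<bullet> principal_normal \<alpha> u = 0"
    and "unit_tangent \<alpha> u \<bullet> binormal \<alpha> u = 0"
    and "principal_normal \<alpha> u \<bullet> binormal \<alpha> u = 0"
    and "principal_normal \<alpha> u \<bullet> unit_tangent \<alpha> u = 0"
    and "binormal \<alpha> u \<bullet> unit_tangent \<alpha> u = 0"
    and "binormal \<alpha> u \<bullet> principal_normal \<alpha> u = 0"
proof -
  show TT: "unit_tangent \<alpha> u \<bullet> unit_tangent \<alpha> u = 1"
    using unit_speed[OF assms] by (simp add: norm_eq_1)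
  show NN: "principal_normal \<alpha> u \<bullet> principal_normal \<alpha> u = 1"
    using norm_principal_normal[OF assms] by (simp add: norm_eq_1)
  show NT: "principal_normal \<alpha> u \<bullet> unit_tangent \<alpha> u = 0"
    using unit_vector_field_orthogonal_derivative[OF open_domain assms unit_speed
        tangent_has_derivative[OF assms]] curvature_nonzero[OF assms]
    by simp
  then show TN: "unit_tangent \<alpha> u \<bullet> principal_normal \<alpha> u = 0"
    by (simp add: inner_commute)
  show "binormal \<alpha> u \<bullet> binormal \<alpha> u = 1"
    by (simp add: binormal_def dot_cross TT NN TN)
  show "unit_tangent \<alpha> u \<bullet> binormal \<alpha> u = 0" "principal_normal \<alpha> u \<bullet> binormal \<alpha> u = 0"
    "binormal \<alpha> u \<bullet> unit_tangent \<alpha> u = 0" "binormal \<alpha> u \<bullet> principal_normal \<alpha> u = 0"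
    by (simp_all add: binormal_def dot_cross_self)
qed

lemma frame_cross:
  assumes "u \<in> J"
  shows "unit_tangent \<alpha> u \<times> principal_normal \<alpha> u = binormal \<alpha> u"
    and "principal_normal \<alpha> u \<times> binormal \<alpha> u = unit_tangent \<alpha> u"
    and "binormal \<alpha> u \<times> unit_tangent \<alpha> u = principal_normal \<alpha> u"
    and "principal_normal \<alpha> u \<times> unit_tangent \<alpha> u = - binormal \<alpha> u"
    and "binormal \<alpha> u \<times> principal_normal \<alpha> u = - unit_tangent \<alpha> u"
    and "unit_tangent \<alpha> u \<times> binormal \<alpha> u = - principal_normal \<alpha> u"
proof -
  show "unit_tangent \<alpha> u \<times> principal_normal \<alpha> u = binormal \<alpha> u"
    by (simp add: binormal_def)
  then show "principal_normal \<alpha> u \<times> unit_tangent \<alpha> u = - binormal \<alpha> u"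
    using cross_skew by metis
  show NB: "principal_normal \<alpha> u \<times> binormal \<alpha> u = unit_tangent \<alpha> u"
    by (simp add: binormal_def Lagrange frame_inner[OF assms])
  then show "binormal \<alpha> u \<times> principal_normal \<alpha> u = - unit_tangent \<alpha> u"
    using cross_skew by metis
  show TB: "unit_tangent \<alpha> u \<times> binormal \<alpha> u = - principal_normal \<alpha> u"
    by (simp add: binormal_def Lagrange frame_inner[OF assms])
  show "binormal \<alpha> u \<times> unit_tangent \<alpha> u = principal_normal \<alpha> u"
    using cross_skew[of "binormal \<alpha> u" "unit_tangent \<alpha> u"] TB by simp
qed

text \<open>
  Since \<open>T' \<times> N = 0\<close>, the product rule leaves \<open>B' = T \<times> N'\<close>. Writing \<open>T = N \<times> B\<close>, the triple product
  expansion and \<open>N' \<bullet> N = 0\<close> make this a multiple of \<open>N\<close>; the factor must be \<open>-\<tau>\<close> by definition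
  of torsion.
\<close>

lemma binormal_has_derivative:
  assumes "u \<in> J"
  shows "(binormal \<alpha> has_vector_derivative - torsion \<alpha> u *\<^sub>R principal_normal \<alpha> u) (at u)"
proof -
  let ?T = "unit_tangent \<alpha> u" and ?N = "principal_normal \<alpha> u" and ?B = "binormal \<alpha> u"
  define N' where "N' = vector_derivative (principal_normal \<alpha>) (at u)"
  have N': "(principal_normal \<alpha> has_vector_derivative N') (at u)"
    unfolding N'_def by (rule smooth_on_has_vector_derivative[OF smooth_principal_normal assms])
  have N'N: "N' \<bullet> ?N = 0"
    by (rule unit_vector_field_orthogonal_derivative[OF open_domain assms norm_principal_normal N'])
  have "(binormal \<alpha> has_vector_derivative ?T \<times> N') (at u)"
    using has_vector_derivative_cross3[OF tangent_has_derivative[OF assms] N']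
    by (simp add: binormal_def[abs_def] cross_mult_left)
  moreover have "?T \<times> N' = - (N' \<bullet> ?B) *\<^sub>R ?N"
  proof -
    have "?T \<times> N' = - (N' \<times> (?N \<times> ?B))"
      using cross_skew frame_cross(2)[OF assms] by metis
    then show ?thesis by (simp add: Lagrange N'N)
  qed
  ultimately have B': "(binormal \<alpha> has_vector_derivative - (N' \<bullet> ?B) *\<^sub>R ?N) (at u)"
    by simp
  moreover have "torsion \<alpha> u = N' \<bullet> ?B"
    by (simp add: torsion_def vector_derivative_at[OF B'] frame_inner[OF assms])
  ultimately show ?thesis by simp
qed

lemma principal_normal_has_derivative:
  assumes "u \<in> J"
  shows "(principal_normal \<alpha> has_vector_derivative
      - curvature \<alpha> u *\<^sub>R unit_tangent \<alpha> u + torsion \<alpha> u *\<^sub>R binormal \<alpha> u) (at u)"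
proof -
  have "((\<lambda>x. binormal \<alpha> x \<times> unit_tangent \<alpha> x) has_vector_derivative
      - curvature \<alpha> u *\<^sub>R unit_tangent \<alpha> u + torsion \<alpha> u *\<^sub>R binormal \<alpha> u) (at u)"
    using has_vector_derivative_cross3[OF binormal_has_derivative[OF assms] tangent_has_derivative[OF assms]]
    by (simp add: cross_mult_left cross_mult_right frame_cross[OF assms])
  then show ?thesis
    by (rule has_vector_derivative_transform_within_open[OF _ open_domain assms])
       (simp add: frame_cross)
qed

end

section \<open>The tangent indicatrix\<close>

locale frenet_curve_tangent_indicatrix = frenet_curve +
  fixes \<sigma> :: "real \<Rightarrow> real"
  assumes interval_domain: "is_interval J"
    and arc_length: "arc_length_parameter (tangent_indicatrix \<alpha>) J \<sigma>"
begin

abbreviation \<beta> :: "real \<Rightarrow> real^3" where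
  "\<beta> \<equiv> reparametrize (tangent_indicatrix \<alpha>) J \<sigma>"

definition f :: "real \<Rightarrow> real" where
  "f = (\<lambda>u. torsion \<alpha> u / curvature \<alpha> u)"

lemma arc_length_derivative:
  "\<forall>u\<in>J. (\<sigma> has_real_derivative curvature \<alpha> u) (at u)" "\<forall>u\<in>J. curvature \<alpha> u > 0"
  using arc_length curvature_pos by (auto simp: arc_length_parameter_def tangent_indicatrix_def curvature_def)

lemmas arc_length_inverse = arc_length_parameter_inverse
    [OF open_domain interval_domain arc_length_derivative]
  and has_vector_derivative_in_arc_length = has_vector_derivative_wrt_arc_length
    [OF open_domain interval_domain arc_length_derivative]

lemma indicatrix_unit_tangent:
  assumes "u \<in> J"
  shows "unit_tangent \<beta> (\<sigma> u) = principal_normal \<alpha> u"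
proof -
  have "(\<beta> has_vector_derivative (1 / curvature \<alpha> u) *\<^sub>R curvature \<alpha> u *\<^sub>R principal_normal \<alpha> u) (at (\<sigma> u))"
    using assms tangent_has_derivative arc_length_inverse(3)
    by (intro has_vector_derivative_in_arc_length[of _ _ "unit_tangent \<alpha>"])
       (auto simp: reparametrize_def tangent_indicatrix_def)
  then show ?thesis
    using curvature_nonzero[OF assms] by (simp add: unit_tangent_def vector_derivative_at)
qed

lemma indicatrix_tangent_derivative:
  assumes "u \<in> J"
  shows "vector_derivative (unit_tangent \<beta>) (at (\<sigma> u)) = - unit_tangent \<alpha> u + f u *\<^sub>R binormal \<alpha> u"
proof -
  have "(unit_tangent \<beta> has_vector_derivative (1 / curvature \<alpha> u) *\<^sub>R
      (- curvature \<alpha> u *\<^sub>R unit_tangent \<alpha> u + torsion \<alpha> u *\<^sub>R binormal \<alpha> u)) (at (\<sigma> u))"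
    by (rule has_vector_derivative_in_arc_length[OF assms indicatrix_unit_tangent
          principal_normal_has_derivative[OF assms]])
  then show ?thesis
    using curvature_nonzero[OF assms] by (simp add: vector_derivative_at scaleR_diff_right f_def)
qed

lemma indicatrix_curvature:
  assumes "u \<in> J"
  shows "curvature \<beta> (\<sigma> u) = sqrt (1 + (f u)\<^sup>2)"
  unfolding curvature_def[of \<beta>] indicatrix_tangent_derivative[OF assms] norm_eq_sqrt_inner
  by (simp add: inner_add_left inner_add_right inner_diff_left inner_diff_right
       frame_inner[OF assms] power2_eq_square)

lemma indicatrix_principal_normal:
  assumes "u \<in> J"
  shows "principal_normal \<beta> (\<sigma> u) =
    (1 / sqrt (1 + (f u)\<^sup>2)) *\<^sub>R (- unit_tangent \<alpha> u + f u *\<^sub>R binormal \<alpha> u)"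
  unfolding principal_normal_def[of \<beta>]
  by (simp add: indicatrix_curvature[OF assms] indicatrix_tangent_derivative[OF assms])

lemma indicatrix_binormal:
  assumes "u \<in> J"
  shows "binormal \<beta> (\<sigma> u) =
    (1 / sqrt (1 + (f u)\<^sup>2)) *\<^sub>R (f u *\<^sub>R unit_tangent \<alpha> u + binormal \<alpha> u)"
  unfolding binormal_def[of \<beta>] indicatrix_unit_tangent[OF assms] indicatrix_principal_normal[OF assms]
  by (simp only: cross_mult_right cross_add_right cross_minus_right frame_cross[OF assms])
     (simp add: add.commute)

text \<open>
  From here the Frenet equations of the indicatrix follow as those of a general curve. Smoothness of the inverse arc length comes from its
  differential equation, whose right-hand side \<open>1/\<kappa>\<close> is smooth.
\<close>

lemma indicatrix_frenet_curve: "frenet_curve \<beta> (\<sigma> ` J)"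
proof
  show "open (\<sigma> ` J)" by (rule arc_length_inverse(1))
  have "smooth_on (\<sigma> ` J) (inv_into J \<sigma>)"
    by (rule smooth_on_inverse_function[OF smooth_on_divide[OF smooth_on_const smooth_curvature curvature_nonzero]])
       (use arc_length_inverse(3,4) in auto)
  then show "smooth_on (\<sigma> ` J) \<beta>"
    unfolding reparametrize_def tangent_indicatrix_def o_def
    by (rule smooth_on_compose[OF smooth_unit_tangent]) (use arc_length_inverse(3) in auto)
  show "norm (unit_tangent \<beta> v) = 1" if "v \<in> \<sigma> ` J" for v
    using that by (auto simp: indicatrix_unit_tangent norm_principal_normal)
  show "curvature \<beta> v \<noteq> 0" if "v \<in> \<sigma> ` J" for v
  proof -
    from that obtain x where "x \<in> J" "v = \<sigma> x" by blast
    moreover have "1 + (f x)\<^sup>2 \<noteq> 0" using zero_le_power2[of "f x"] by linarith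
    ultimately show ?thesis by (simp add: indicatrix_curvature)
  qed
qed

lemma smooth_torsion_curvature_ratio: "smooth_on J f"
  unfolding f_def by (rule smooth_on_divide[OF smooth_torsion smooth_curvature curvature_nonzero])

lemma sqrt_ratio_has_derivative:
  assumes "u \<in> J"
  shows "((\<lambda>u. sqrt (1 + (f u)\<^sup>2)) has_real_derivative f u * deriv f u / sqrt (1 + (f u)\<^sup>2)) (at u)"
proof -
  have "1 + (f u)\<^sup>2 > 0" using zero_le_power2[of "f u"] by linarith
  then show ?thesis
    using smooth_on_has_real_derivative[OF smooth_torsion_curvature_ratio assms]
    by (auto intro!: derivative_eq_intros simp: field_simps)
qed

text \<open>
  In the derivative of \<open>(f T + B)/w\<close> the part coming from \<open>1/w\<close> is parallel to \<open>f T + B\<close>, so it is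
  orthogonal to the principal normal \<open>(-T + f B)/w\<close>; only \<open>f' T / w\<close> contributes to the torsion.
\<close>

lemma indicatrix_torsion:
  assumes "u \<in> J"
  shows "torsion \<beta> (\<sigma> u) = deriv f u / (curvature \<alpha> u * (1 + (f u)\<^sup>2))"
proof -
  let ?T = "unit_tangent \<alpha>" and ?N = "principal_normal \<alpha>" and ?B = "binormal \<alpha>"
  define w where "w = (\<lambda>u. sqrt (1 + (f u)\<^sup>2))"
  have pos: "w u > 0" and w2: "(w u)\<^sup>2 = 1 + (f u)\<^sup>2" 
    using zero_le_power2[of "f u"] unfolding w_def by (simp_all add: add_pos_nonneg)
  note f' = smooth_on_has_real_derivative[OF smooth_torsion_curvature_ratio assms]
  have "((\<lambda>u. f u *\<^sub>R ?T u + ?B u) has_vector_derivative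
      (f u *\<^sub>R curvature \<alpha> u *\<^sub>R ?N u + deriv f u *\<^sub>R ?T u) + - torsion \<alpha> u *\<^sub>R ?N u) (at u)"
    by (intro has_vector_derivative_add has_vector_derivative_scaleR f'
        tangent_has_derivative[OF assms] binormal_has_derivative[OF assms])
  \<comment> \<open>the two normal components cancel, because \<open>f * curvature = torsion\<close>\<close>
  then have num: "((\<lambda>u. f u *\<^sub>R ?T u + ?B u) has_vector_derivative deriv f u *\<^sub>R ?T u) (at u)"
    using curvature_nonzero[OF assms] by (simp add: f_def)
  have inv_w: "((\<lambda>u. 1 / w u) has_real_derivative - (f u * deriv f u / w u ^ 3)) (at u)"
    using sqrt_ratio_has_derivative[OF assms] pos unfolding fun_cong[OF w_def, symmetric]
    by (auto intro!: derivative_eq_intros simp: power2_eq_square power3_eq_cube field_simps)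
  have "(binormal \<beta> has_vector_derivative (1 / curvature \<alpha> u) *\<^sub>R
      ((1 / w u) *\<^sub>R deriv f u *\<^sub>R ?T u
        + - (f u * deriv f u / w u ^ 3) *\<^sub>R (f u *\<^sub>R ?T u + ?B u))) (at (\<sigma> u))"
    by (rule has_vector_derivative_in_arc_length
          [OF assms _ has_vector_derivative_scaleR[OF inv_w num]])
       (simp add: indicatrix_binormal w_def)
  then have "torsion \<beta> (\<sigma> u) = - ((1 / curvature \<alpha> u) *\<^sub>R
      ((1 / w u) *\<^sub>R deriv f u *\<^sub>R ?T u
        + - (f u * deriv f u / w u ^ 3) *\<^sub>R (f u *\<^sub>R ?T u + ?B u))
      \<bullet> (1 / w u) *\<^sub>R (- ?T u + f u *\<^sub>R ?B u))"
    by (simp only: torsion_def[of \<beta>] vector_derivative_at indicatrix_principal_normal[OF assms] w_def)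
  also have "\<dots> = deriv f u / (curvature \<alpha> u * (w u)\<^sup>2)"
    using pos curvature_nonzero[OF assms]
    by (simp add: inner_add_left inner_add_right inner_diff_left inner_diff_right
        frame_inner[OF assms] field_simps eval_nat_numeral)
  finally show ?thesis by (simp only: w2)
qed

text \<open>
  The quantity to differentiate is \<open>G = f'/(\<kappa> w\<^sup>3)\<close>. All bases of the powers with exponent \<open>3/2\<close> are
  squares of positive numbers: \<open>1 + f\<^sup>2 = w\<^sup>2\<close>, and with \<open>Y\<^sup>2 = \<kappa>\<^sup>2 w\<^sup>6 + f'\<^sup>2\<close> also
  \<open>1 + G\<^sup>2 = (Y/(\<kappa> w\<^sup>3))\<^sup>2\<close>. After these substitutions the identity is one of rational functions.
\<close>

lemma indicatrix_normal_indicatrix_geodesic_curvature: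
  assumes "u \<in> J"
  defines "k \<equiv> curvature \<alpha>"
  shows "normal_indicatrix_geodesic_curvature \<beta> (\<sigma> u) =
        ((1 + (f u)\<^sup>2) * (deriv (deriv f) u * k u - deriv f u * deriv k u)
           - 3 * k u * f u * (deriv f u)\<^sup>2) * (1 + (f u)\<^sup>2) powr (3/2)
        / ((k u)\<^sup>2 * (1 + (f u)\<^sup>2) ^ 3 + (deriv f u)\<^sup>2) powr (3/2)"
proof -
  define w where "w = (\<lambda>u. sqrt (1 + (f u)\<^sup>2))"
  have pos: "w x > 0" and w2: "1 + (f x)\<^sup>2 = (w x)\<^sup>2" for x
    using zero_le_power2[of "f x"] unfolding w_def by (simp_all add: add_pos_nonneg)
  have k: "k u > 0" using curvature_pos[OF assms(1)] by (simp add: k_def)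
  note f = smooth_torsion_curvature_ratio
  note f'' = smooth_on_has_real_derivative[OF smooth_on_deriv[OF f open_domain] assms(1)]
  have k': "(k has_real_derivative deriv k u) (at u)"
    unfolding k_def by (rule smooth_on_has_real_derivative[OF smooth_curvature assms(1)])
  have w': "(w has_real_derivative f u * deriv f u / w u) (at u)"
    using sqrt_ratio_has_derivative[OF assms(1)] unfolding w_def .
  define G where "G = (\<lambda>x. deriv f x / (k x * w x ^ 3))"
  define G' where "G' = ((w u)\<^sup>2 * (deriv (deriv f) u * k u - deriv f u * deriv k u)
           - 3 * k u * f u * (deriv f u)\<^sup>2) / ((k u)\<^sup>2 * w u ^ 5)"
  have ratio: "torsion \<beta> (\<sigma> x) / curvature \<beta> (\<sigma> x) = G x" if "x \<in> J" for x
    unfolding indicatrix_torsion[OF that] indicatrix_curvature[OF that] G_def w2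
    using pos[of x] by (simp add: k_def power2_eq_square power3_eq_cube)
  have "(G has_real_derivative G') (at u)"
    unfolding G_def
    by (rule derivative_eq_intros f'' k' w' refl)+
       (use k pos[of u] in \<open>auto simp: G'_def field_simps eval_nat_numeral\<close>)
  then have "((\<lambda>x. torsion \<beta> x / curvature \<beta> x) has_vector_derivative (1 / curvature \<alpha> u) *\<^sub>R G') (at (\<sigma> u))"
    by (intro has_vector_derivative_in_arc_length[where h = G, OF assms(1)])
       (auto simp: ratio has_real_derivative_iff_has_vector_derivative)
  then have deriv: "deriv (\<lambda>x. torsion \<beta> x / curvature \<beta> x) (\<sigma> u) = G' / k u"
    by (intro DERIV_imp_deriv) (simp add: has_real_derivative_iff_has_vector_derivative k_def)
  have powr: "(y\<^sup>2) powr (3/2) = y ^ 3" if "y > 0" for y :: real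
  proof -
    have "(y\<^sup>2) powr (3/2) = (y powr 2) powr (3/2)" using that by simp
    also have "\<dots> = y powr 3" by (simp add: powr_powr)
    finally show ?thesis using that by simp
  qed
  define Y where "Y = sqrt ((k u * w u ^ 3)\<^sup>2 + (deriv f u)\<^sup>2)"
  have "(k u * w u ^ 3)\<^sup>2 + (deriv f u)\<^sup>2 > 0"
    using k pos[of u] by (intro add_pos_nonneg) auto
  then have Y: "Y > 0" and Y2: "(k u * w u ^ 3)\<^sup>2 + (deriv f u)\<^sup>2 = Y\<^sup>2"
    by (simp_all add: Y_def)
  have "1 + (G u)\<^sup>2 = (Y / (k u * w u ^ 3))\<^sup>2"
    using k pos[of u] by (simp add: G_def power_divide flip: Y2) (simp add: field_simps)
  then have G: "(1 + (G u)\<^sup>2) powr (3/2) = (Y / (k u * w u ^ 3)) ^ 3"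
    using powr k pos[of u] Y by simp
  have X: "(k u)\<^sup>2 * ((w u)\<^sup>2) ^ 3 + (deriv f u)\<^sup>2 = Y\<^sup>2"
    unfolding Y2[symmetric] by (simp add: power_mult_distrib flip: power_mult)
  have "normal_indicatrix_geodesic_curvature \<beta> (\<sigma> u) = G' / k u / (w u * (Y / (k u * w u ^ 3)) ^ 3)"
    by (simp only: normal_indicatrix_geodesic_curvature_def deriv ratio[OF assms(1)] G)
       (simp only: indicatrix_curvature[OF assms(1)] w_def)
  also have "\<dots> = ((w u)\<^sup>2 * (deriv (deriv f) u * k u - deriv f u * deriv k u)
           - 3 * k u * f u * (deriv f u)\<^sup>2) * w u ^ 3 / Y ^ 3"
  proof -
    have "A / ((k u)\<^sup>2 * w u ^ 5) / k u / (w u * (Y / (k u * w u ^ 3)) ^ 3) = A * w u ^ 3 / Y ^ 3" for A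
      using k pos[of u] Y by (simp add: field_simps eval_nat_numeral)
    then show ?thesis unfolding G'_def .
  qed
  finally show ?thesis
    unfolding w2 X powr[OF Y] powr[OF pos] .
qed

end

section \<open>The involute\<close>

text \<open>
  The condition \<open>c - s > 0\<close> fixes the sign of the speed \<open>(c - s) \<kappa>\<close>, so that the unit tangent of the
  involute is \<open>N\<close> and not \<open>-N\<close>. Its curvature cannot vanish, because the derivative of \<open>N\<close> has the
  nonzero component \<open>-\<kappa>\<close> along \<open>T\<close>.
\<close>

lemma involute_unit_speed_reparametrization:
  fixes \<gamma> :: "real \<Rightarrow> real^3"
  assumes "frenet_curve \<gamma> I" "is_interval I"
    and c: "\<And>s. s \<in> I \<Longrightarrow> c - s > 0"
    and len: "arc_length_parameter (involute \<gamma> c) I \<sigma>"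
  shows "frenet_curve (reparametrize (involute \<gamma> c) I \<sigma>) (\<sigma> ` I)" and "is_interval (\<sigma> ` I)"
proof -
  interpret \<gamma>: frenet_curve \<gamma> I by fact
  let ?\<alpha> = "reparametrize (involute \<gamma> c) I \<sigma>"
  \<comment> \<open>the speed of the involute\<close>
  define r where "r = (\<lambda>s. (c - s) * curvature \<gamma> s)"
  have r_pos: "r s > 0" if "s \<in> I" for s
    using c[OF that] \<gamma>.curvature_pos[OF that] by (simp add: r_def)
  have r_smooth: "smooth_on I r"
    unfolding r_def using smooth_on_add[OF smooth_on_const smooth_on_minus[OF smooth_on_id], of I c]
    by (intro smooth_on_mult \<gamma>.smooth_curvature) simp
  have inv': "(involute \<gamma> c has_vector_derivative r s *\<^sub>R principal_normal \<gamma> s) (at s)"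
    if "s \<in> I" for s
  proof -
    have "(\<gamma> has_vector_derivative unit_tangent \<gamma> s) (at s)"
      unfolding unit_tangent_def by (rule smooth_on_has_vector_derivative[OF \<gamma>.smooth that])
    then have "((\<lambda>s. \<gamma> s + (c - s) *\<^sub>R unit_tangent \<gamma> s) has_vector_derivative
       unit_tangent \<gamma> s + ((c - s) *\<^sub>R curvature \<gamma> s *\<^sub>R principal_normal \<gamma> s + (0 - 1) *\<^sub>R unit_tangent \<gamma> s)) (at s)"
      by (intro has_vector_derivative_add has_vector_derivative_scaleR \<gamma>.tangent_has_derivative that
          DERIV_diff DERIV_const DERIV_ident)
    then show ?thesis by (simp add: involute_def[abs_def] r_def)
  qed
  have \<sigma>': "(\<sigma> has_real_derivative r s) (at s)" if "s \<in> I" for s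
  proof -
    have "norm (vector_derivative (involute \<gamma> c) (at s)) = r s"
      using r_pos[OF that] \<gamma>.norm_principal_normal[OF that]
      by (simp add: vector_derivative_at[OF inv'[OF that]])
    moreover have "(\<sigma> has_real_derivative norm (vector_derivative (involute \<gamma> c) (at s))) (at s)"
      using len that by (simp add: arc_length_parameter_def)
    ultimately show ?thesis by simp
  qed
  have "\<forall>s\<in>I. (\<sigma> has_real_derivative r s) (at s)" "\<forall>s\<in>I. r s > 0"
    using \<sigma>' r_pos by auto
  note domain = \<gamma>.open_domain assms(2) this
  note inverse = arc_length_parameter_inverse[OF domain]
  note in_arc_length = has_vector_derivative_wrt_arc_length[OF domain]
  have T: "unit_tangent ?\<alpha> (\<sigma> s) = principal_normal \<gamma> s" if "s \<in> I" for s
    using in_arc_length[OF that _ inv'[OF that], of ?\<alpha>] r_pos[OF that] inverse(3)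
    by (simp add: reparametrize_def unit_tangent_def vector_derivative_at)
  show "is_interval (\<sigma> ` I)" by (rule inverse(2))
  show "frenet_curve ?\<alpha> (\<sigma> ` I)"
  proof
    show "open (\<sigma> ` I)" by (rule inverse(1))
    have "smooth_on I (involute \<gamma> c)"
      unfolding involute_def[abs_def]
      using smooth_on_add[OF smooth_on_const smooth_on_minus[OF smooth_on_id], of I c]
      by (intro smooth_on_add smooth_on_scaleR \<gamma>.smooth \<gamma>.smooth_unit_tangent) simp
    moreover have "smooth_on (\<sigma> ` I) (inv_into I \<sigma>)"
      by (rule smooth_on_inverse_function[OF smooth_on_divide[OF smooth_on_const r_smooth]])
         (use inverse(3,4) r_pos in force)+
    ultimately show "smooth_on (\<sigma> ` I) ?\<alpha>"
      unfolding reparametrize_def o_def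
      by (rule smooth_on_compose) (use inverse(3) in auto)
    show "norm (unit_tangent ?\<alpha> u) = 1" if "u \<in> \<sigma> ` I" for u
      using that T \<gamma>.norm_principal_normal by auto
    show "curvature ?\<alpha> u \<noteq> 0" if "u \<in> \<sigma> ` I" for u
    proof
      assume *: "curvature ?\<alpha> u = 0"
      from that obtain s where s: "s \<in> I" "u = \<sigma> s" by blast
      have "(unit_tangent ?\<alpha> has_vector_derivative (1 / r s) *\<^sub>R
          (- curvature \<gamma> s *\<^sub>R unit_tangent \<gamma> s + torsion \<gamma> s *\<^sub>R binormal \<gamma> s)) (at (\<sigma> s))"
        by (rule in_arc_length[OF s(1) T \<gamma>.principal_normal_has_derivative[OF s(1)]])
      then have "(1 / r s) *\<^sub>R
          (- curvature \<gamma> s *\<^sub>R unit_tangent \<gamma> s + torsion \<gamma> s *\<^sub>R binormal \<gamma> s) = 0"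
        using * unfolding curvature_def[of ?\<alpha>] s(2) norm_eq_zero by (simp only: vector_derivative_at)
      then have "(- curvature \<gamma> s *\<^sub>R unit_tangent \<gamma> s + torsion \<gamma> s *\<^sub>R binormal \<gamma> s) \<bullet> unit_tangent \<gamma> s = 0"
        using r_pos[OF s(1)] by simp
      then show False
        using \<gamma>.curvature_nonzero[OF s(1)] by (simp add: inner_diff_left inner_add_left \<gamma>.frame_inner[OF s(1)])
    qed
  qed
qed

section \<open>The tangent indicatrix of the involute\<close>

theorem theorem4:
  fixes \<gamma> :: "real \<Rightarrow> real^3" and I :: "real set" and c :: real
    and s_star s_t_star :: "real \<Rightarrow> real"
  assumes "open I" and "is_interval I"
    and "smooth_curve_on I \<gamma>"
    and "\<forall>s\<in>I. norm (vector_derivative \<gamma> (at s)) = 1"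
    and "\<forall>s\<in>I. curvature \<gamma> s \<noteq> 0"
    and "\<forall>s\<in>I. c - s > 0"
    and "arc_length_parameter (involute \<gamma> c) I s_star"
  defines "J \<equiv> s_star ` I"
    and "\<alpha> \<equiv> reparametrize (involute \<gamma> c) I s_star"
  assumes "arc_length_parameter (tangent_indicatrix \<alpha>) J s_t_star"
  defines "\<beta> \<equiv> reparametrize (tangent_indicatrix \<alpha>) J s_t_star"
    and "\<kappa> \<equiv> curvature \<alpha>"
    and "f \<equiv> (\<lambda>u. torsion \<alpha> u / curvature \<alpha> u)"
  shows "\<forall>u\<in>J. let v = s_t_star u in
      \<kappa> u > 0
    \<and> (inv_into J s_t_star has_real_derivative 1 / \<kappa> u) (at v)
    \<and> unit_tangent \<beta> v = principal_normal \<alpha> u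
    \<and> principal_normal \<beta> v =
        (1 / sqrt (1 + (f u)\<^sup>2)) *\<^sub>R (- unit_tangent \<alpha> u + f u *\<^sub>R binormal \<alpha> u)
    \<and> binormal \<beta> v =
        (1 / sqrt (1 + (f u)\<^sup>2)) *\<^sub>R (f u *\<^sub>R unit_tangent \<alpha> u + binormal \<alpha> u)
    \<and> (unit_tangent \<beta> has_vector_derivative curvature \<beta> v *\<^sub>R principal_normal \<beta> v) (at v)
    \<and> (principal_normal \<beta> has_vector_derivative
        - curvature \<beta> v *\<^sub>R unit_tangent \<beta> v + torsion \<beta> v *\<^sub>R binormal \<beta> v) (at v)
    \<and> (binormal \<beta> has_vector_derivative - torsion \<beta> v *\<^sub>R principal_normal \<beta> v) (at v)
    \<and> curvature \<beta> v = sqrt (1 + (f u)\<^sup>2)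
    \<and> torsion \<beta> v = deriv f u / (\<kappa> u * (1 + (f u)\<^sup>2))
    \<and> normal_indicatrix_geodesic_curvature \<beta> v =
        ((1 + (f u)\<^sup>2) * (deriv (deriv f) u * \<kappa> u - deriv f u * deriv \<kappa> u)
           - 3 * \<kappa> u * f u * (deriv f u)\<^sup>2) * (1 + (f u)\<^sup>2) powr (3/2)
        / ((\<kappa> u)\<^sup>2 * (1 + (f u)\<^sup>2) ^ 3 + (deriv f u)\<^sup>2) powr (3/2)"
proof -
  have "frenet_curve \<gamma> I"
    using assms(1,3,4,5) smooth_curve_on_imp_smooth_on
    by unfold_locales (auto simp: unit_tangent_def)
  note \<alpha> = involute_unit_speed_reparametrization[OF this assms(2) _ assms(7), folded J_def \<alpha>_def]
  interpret ind: frenet_curve_tangent_indicatrix \<alpha> J s_t_star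
    using \<alpha> assms(6,10)
    by (intro frenet_curve_tangent_indicatrix.intro frenet_curve_tangent_indicatrix_axioms.intro) auto
  have f_eq: "ind.f = f"
    by (simp add: ind.f_def f_def)
  interpret \<beta>: frenet_curve \<beta> "s_t_star ` J"
    unfolding \<beta>_def by (rule ind.indicatrix_frenet_curve)
  show ?thesis
    unfolding Let_def
    apply (intro ballI conjI)
    subgoal by (simp add: \<kappa>_def ind.curvature_pos)
    subgoal by (simp add: \<kappa>_def ind.arc_length_inverse(4))
    subgoal by (simp only: \<beta>_def ind.indicatrix_unit_tangent)
    subgoal by (simp only: \<beta>_def ind.indicatrix_principal_normal[unfolded f_eq])
    subgoal by (simp only: \<beta>_def ind.indicatrix_binormal[unfolded f_eq])
    subgoal by (rule \<beta>.tangent_has_derivative) simp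
    subgoal by (rule \<beta>.principal_normal_has_derivative) simp
    subgoal by (rule \<beta>.binormal_has_derivative) simp
    subgoal by (simp only: \<beta>_def ind.indicatrix_curvature[unfolded f_eq])
    subgoal by (simp only: \<beta>_def \<kappa>_def ind.indicatrix_torsion[unfolded f_eq])
    subgoal by (simp only: \<beta>_def \<kappa>_def ind.indicatrix_normal_indicatrix_geodesic_curvature[unfolded f_eq])
    done
qed

end
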